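(* Let $\mathbf A\in\mathbb C^{n\times n}$ with $\operatorname{Ind}\mathbf A=k$ and $\operatorname{rank}\mathbf A^{k+1}=\operatorname{rank}\mathbf A^{k}=r\le n$. Then the Drazin inverse $\mathbf A^{D}=(a^{D}_{ij})$ satisfies, for all $i,j=1,\dots,n$, \[ a^{D}_{ij}=\frac{\sum_{\alpha\in I_{r,n}\{j\}}\left|\left(\mathbf A^{k+1}_{j.}(\mathbf a^{(k)}_{i.})\right)^{\alpha}_{\alpha}\right|}{\sum_{\alpha\in I_{r,n}}\left|(\mathbf A^{k+1})^{\alpha}_{\alpha}\right|} \quad\text{and}\quad a^{D}_{ij}=\frac{\sum_{\beta\in J_{r,n}\{i\}}\left|\left(\mathbf A^{k+1}_{.i}(\mathbf a^{(k)}_{.j})\right)^{\beta}_{\beta}\right|}{\sum_{\beta\in J_{r,n}}\left|(\mathbf A^{k+1})^{\beta}_{\beta}\right|}, \] where $\mathbf a^{(k)}_{i.}$ and $\mathbf a^{(k)}_{.j}$ denote the $i$-th row and the $j$-th column of $\mathbf A^{k}$.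
   Context: All matrices are complex. $\operatorname{Ind}\mathbf A$ is the smallest nonnegative integer $k$ with $\operatorname{rank}\mathbf A^{k+1}=\operatorname{rank}\mathbf A^{k}$. The Drazin inverse $\mathbf A^{D}$ is the unique $\mathbf X$ with $\mathbf A^{k+1}\mathbf X=\mathbf A^{k}$, $\mathbf X\mathbf A\mathbf X=\mathbf X$, $\mathbf A\mathbf X=\mathbf X\mathbf A$, where $k=\operatorname{Ind}\mathbf A$. For a square matrix $\mathbf M$, $\mathbf M_{.i}(\mathbf c)$ (resp. $\mathbf M_{i.}(\mathbf c)$) is the matrix obtained from $\mathbf M$ by replacing its $i$-th column (resp. row) by the column (resp. row) vector $\mathbf c$. For $1\le k\le p$, $L_{k,p}$ is the set of strictly increasing sequences of $k$ elements of $\{1,\dots,p\}$; $I_{k,p}=J_{k,p}=L_{k,p}$, and $I_{k,p}\{i\}=J_{k,p}\{i\}=\{\alpha\in L_{k,p}:i\in\alpha\}$. $\mathbf M^{\alpha}_{\alpha}$ is the principal submatrix with rows and columns indexed by $\alpha$, and $|\cdot|$ denotes the determinant. *)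

theory Defs
  imports "Jordan_Normal_Form.Determinant" "Jordan_Normal_Form.DL_Rank" "Jordan_Normal_Form.DL_Submatrix"
begin

definition crank :: "complex mat \<Rightarrow> nat" where
  "crank A = vec_space.rank (dim_row A) A"

definition mat_index :: "complex mat \<Rightarrow> nat" where
  "mat_index A = (LEAST k. crank (A ^\<^sub>m (Suc k)) = crank (A ^\<^sub>m k))"

definition is_drazin_inverse :: "complex mat \<Rightarrow> complex mat \<Rightarrow> bool" where
  "is_drazin_inverse A X \<longleftrightarrow>
     X \<in> carrier_mat (dim_row A) (dim_col A) \<and>
     A ^\<^sub>m (Suc (mat_index A)) * X = A ^\<^sub>m (mat_index A) \<and>
     X * A * X = X \<and> A * X = X * A"

definition replace_row :: "'a mat \<Rightarrow> 'a vec \<Rightarrow> nat \<Rightarrow> 'a mat" where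
  "replace_row M c i = mat (dim_row M) (dim_col M) (\<lambda>(a,b). if a = i then c $ b else M $$ (a,b))"

definition principal_submatrix :: "'a mat \<Rightarrow> nat set \<Rightarrow> 'a mat" where
  "principal_submatrix M \<alpha> = submatrix M \<alpha> \<alpha>"

end

theory Submission
  imports Defs "Jordan_Normal_Form.Matrix_Kernel" "Jordan_Normal_Form.DL_Rank_Submatrix"
begin

text \<open>
  Put $M = A^{k+1}$ and let $x$ be a column of the Drazin inverse $X$, so that $x$ lies in the
  range of $M$ and $Mx$ is the corresponding column of $A^k$. Cramer's rule for the matrix
  $M + tI$ and the vector $x$ gives an identity between two polynomials in $t$ whose coefficients
  are sums of principal minors. Minors of size greater than $r$ vanish because all matrices involved
  factor through $M$; dividing by $t^{n-r}$ and letting $t \to 0$ leaves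
  $x_i \, e_r(M) = \sum_{\beta \ni i} |M_{.i}(Mx)^\beta_\beta|$,
  where $e_r(M)$ is the sum of the principal minors of size $r$. Rows are treated by transposition.

  The denominator $e_r(M)$ is nonzero: with the projection $F = I - AX$ one has
  $(M + tI)(F + tI) = t\,(F + M + tI)$, where $F + M$ is invertible and the ranks of $M$ and
  $F$ add up to at most $n$. Comparing the lowest order terms of the determinants at $t = 0$
  shows that $e_r(M)$ is a factor of $\det (F + M)$.
\<close>

section \<open>Principal minors and the expansion of a determinant along a diagonal
  perturbation\<close>

lemma bij_betw_pick:
  assumes "finite S"
  shows "bij_betw (pick S) {0..<card S} S"
proof -
  have inj: "inj_on (pick S) {0..<card S}"
    by (rule linorder_inj_onI) (auto dest: pick_mono_le[of _ S])
  moreover have "pick S ` {0..<card S} \<subseteq> S"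
    by (auto intro: pick_in_set_le)
  ultimately show ?thesis
    using assms card_subset_eq[of S "pick S ` {0..<card S}"]
    by (simp add: bij_betw_def card_image)
qed

lemma principal_submatrix_carrier:
  assumes "A \<in> carrier_mat n n" "S \<subseteq> {0..<n}"
  shows "principal_submatrix A S \<in> carrier_mat (card S) (card S)"
proof -
  have "{i. i < n \<and> i \<in> S} = S" using assms(2) by auto
  then show ?thesis
    using assms(1) by (intro carrier_matI) (simp_all add: principal_submatrix_def dim_submatrix)
qed

text \<open>Leibniz formula transported along \<open>pick S\<close>, the increasing enumeration of
  \<open>S\<close>; conjugation by it preserves signs. Indexing by permutations of \<open>S\<close>
  itself makes minors for different \<open>S\<close> comparable inside the permutations of the full
  index set.\<close>

lemma det_principal_submatrix:
  fixes A :: "'a :: comm_ring_1 mat"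
  assumes A: "A \<in> carrier_mat n n" and S: "S \<subseteq> {0..<n}"
  shows "det (principal_submatrix A S) =
    (\<Sum>p | p permutes S. signof p * (\<Prod>i\<in>S. A $$ (i, p i)))"
proof -
  let ?I = "{0..<card S}" and ?f = "pick S"
  have fin: "finite S" using S finite_subset by blast
  have bij: "bij_betw ?f ?I S" by (rule bij_betw_pick[OF fin])
  have inj: "inj_on ?f ?I" using bij by (rule bij_betw_imp_inj_on)
  have eq: "{i. i < n \<and> i \<in> S} = S" using S by auto
  have entry: "principal_submatrix A S $$ (i, j) = A $$ (?f i, ?f j)"
    if "i < card S" "j < card S" for i j
    using that A by (simp add: principal_submatrix_def submatrix_index eq)
  have "det (principal_submatrix A S) =
      (\<Sum>p | p permutes ?I. signof p * (\<Prod>i\<in>?I. A $$ (?f i, ?f (p i))))"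
    unfolding det_def'[OF principal_submatrix_carrier[OF A S]]
    by (intro sum.cong prod.cong arg_cong2[where f = times] refl)
      (auto simp: entry dest: permutes_in_image)
  also have "\<dots> = (\<Sum>p | p permutes ?I. signof (map_permutation ?I ?f p) *
      (\<Prod>i\<in>S. A $$ (i, map_permutation ?I ?f p i)))"
  proof (intro sum.cong refl arg_cong2[where f = times])
    fix p assume "p \<in> {p. p permutes ?I}"
    then have p: "p permutes ?I" by simp
    show "(signof p :: 'a) = signof (map_permutation ?I ?f p)"
      using sign_map_permutation[OF inj p] by simp
    show "(\<Prod>i\<in>?I. A $$ (?f i, ?f (p i))) = (\<Prod>i\<in>S. A $$ (i, map_permutation ?I ?f p i))"
      by (subst prod.reindex_bij_betw[OF bij, symmetric])
        (simp add: map_permutation_apply[OF inj])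
  qed
  also have "\<dots> = (\<Sum>p | p permutes S. signof p * (\<Prod>i\<in>S. A $$ (i, p i)))"
  proof (rule sum.reindex_bij_betw)
    \<comment> \<open>Unfolds \<open>map_permutation\<close> into the explicit conjugation for which
      \<open>bij_betw_permutations\<close> is stated.\<close>
    have "map_permutation ?I ?f = (\<lambda>p x. if x \<in> S then ?f (p (inv_into ?I ?f x)) else x)"
      using bij by (auto simp: map_permutation_def restrict_id_def bij_betw_def fun_eq_iff)
    then show "bij_betw (map_permutation ?I ?f) {p. p permutes ?I} {p. p permutes S}"
      using bij_betw_permutations[OF bij] by simp
  qed
  finally show ?thesis .
qed

text \<open>In each Leibniz product every factor is a sum of an entry of \<open>A\<close> and a
  diagonal entry. Multiplying out chooses the set \<open>S\<close> of rows where \<open>A\<close>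
  contributes; off \<open>S\<close> only fixed points survive, so the remaining permutations are
  those of \<open>S\<close>.\<close>

lemma det_add_diagonal:
  fixes A :: "'a :: comm_ring_1 mat"
  assumes A: "A \<in> carrier_mat n n"
  shows "det (A + mat n n (\<lambda>(i, j). if i = j then d i else 0)) =
    (\<Sum>S | S \<subseteq> {0..<n}. (\<Prod>i\<in>{0..<n} - S. d i) * det (principal_submatrix A S))"
proof -
  let ?U = "{0..<n}"
  let ?h = "\<lambda>p S. signof p * ((\<Prod>i\<in>S. A $$ (i, p i)) * (\<Prod>i\<in>?U - S. if i = p i then d i else 0))"
  have C: "A + mat n n (\<lambda>(i, j). if i = j then d i else 0) \<in> carrier_mat n n"
    using A by simp
  have "det (A + mat n n (\<lambda>(i, j). if i = j then d i else 0)) =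
      (\<Sum>p | p permutes ?U. signof p * (\<Prod>i\<in>?U. A $$ (i, p i) + (if i = p i then d i else 0)))"
    unfolding det_def'[OF C] using A
    by (intro sum.cong prod.cong arg_cong2[where f = times] refl) (auto dest: permutes_in_image)
  also have "\<dots> = (\<Sum>p | p permutes ?U. \<Sum>S\<in>Pow ?U. ?h p S)"
    by (simp add: prod_add sum_distrib_left)
  also have "\<dots> = (\<Sum>S\<in>Pow ?U. \<Sum>p | p permutes ?U. ?h p S)"
    by (rule sum.swap)
  also have "\<dots> = (\<Sum>S\<in>Pow ?U. (\<Prod>i\<in>?U - S. d i) * det (principal_submatrix A S))"
  proof (rule sum.cong[OF refl])
    fix S assume "S \<in> Pow ?U"
    then have S: "S \<subseteq> ?U" by simp
    have "(\<Sum>p | p permutes ?U. ?h p S) = (\<Sum>p | p permutes S. ?h p S)"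
    proof (rule sum.mono_neutral_right)
      show "finite {p. p permutes ?U}" by (simp add: finite_permutations)
      show "{p. p permutes S} \<subseteq> {p. p permutes ?U}" using S by (auto intro: permutes_subset)
      show "\<forall>p\<in>{p. p permutes ?U} - {p. p permutes S}. ?h p S = 0"
      proof
        fix p assume "p \<in> {p. p permutes ?U} - {p. p permutes S}"
        then have p: "p permutes ?U" and np: "\<not> p permutes S" by auto
        \<comment> \<open>A permutation of the whole index set that fixes every point outside
          \<open>S\<close> would permute \<open>S\<close>. The moved point found here makes one
          diagonal factor zero.\<close>
        have "\<exists>i\<in>?U - S. p i \<noteq> i"
          using np permutes_superset[OF p, of S] by fastforce
        then have "(\<Prod>i\<in>?U - S. if i = p i then d i else 0) = 0"
          by (intro prod_zero) force+
        then show "?h p S = 0" by simp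
      qed
    qed
    also have "\<dots> = (\<Sum>p | p permutes S. (\<Prod>i\<in>?U - S. d i) * (signof p * (\<Prod>i\<in>S. A $$ (i, p i))))"
    proof (rule sum.cong[OF refl])
      fix p assume "p \<in> {p. p permutes S}"
      then have "(\<Prod>i\<in>?U - S. if i = p i then d i else 0) = (\<Prod>i\<in>?U - S. d i)"
        by (intro prod.cong) (auto simp: permutes_not_in)
      then show "?h p S = (\<Prod>i\<in>?U - S. d i) * (signof p * (\<Prod>i\<in>S. A $$ (i, p i)))"
        by (simp add: mult_ac)
    qed
    also have "\<dots> = (\<Prod>i\<in>?U - S. d i) * det (principal_submatrix A S)"
      by (simp add: det_principal_submatrix[OF A S] sum_distrib_left)
    finally show "(\<Sum>p | p permutes ?U. ?h p S) = (\<Prod>i\<in>?U - S. d i) * det (principal_submatrix A S)" .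
  qed
  finally show ?thesis by (simp add: Pow_def)
qed

section \<open>Rank, kernel and vanishing minors of square matrices\<close>

context vec_space
begin

lemma linear_map_mult_mat_vec:
  assumes A: "A \<in> carrier_mat n n"
  shows "linear_map class_ring V V ((*\<^sub>v) A)"
  by unfold_locales
    (use A mult_add_distrib_mat_vec[OF A] mult_mat_vec[OF A] in
      \<open>auto simp: LinearCombinations.module_hom_def\<close>)

lemma mat_kernel_eq_ker:
  assumes A: "A \<in> carrier_mat n n"
  shows "mod_hom.ker V V ((*\<^sub>v) A) = mat_kernel A"
proof -
  interpret L: linear_map class_ring V V "(*\<^sub>v) A"
    by (rule linear_map_mult_mat_vec[OF A])
  show ?thesis by (auto simp: L.ker_def mat_kernel[OF A])
qed

lemma mat_kernel_subspace:
  assumes A: "A \<in> carrier_mat n n"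
  shows "VectorSpace.subspace class_ring (mat_kernel A) V"
    and "vectorspace.fin_dim class_ring (vs (mat_kernel A))"
proof -
  interpret L: linear_map class_ring V V "(*\<^sub>v) A"
    by (rule linear_map_mult_mat_vec[OF A])
  show "VectorSpace.subspace class_ring (mat_kernel A) V"
    using L.kerT_is_subspace by (simp add: mat_kernel_eq_ker[OF A])
  interpret K: kernel n n A by unfold_locales (rule A)
  obtain B where "finite B" "K.basis B"
    using kernel_basis_exists[OF A] by blast
  then show "vectorspace.fin_dim class_ring (vs (mat_kernel A))"
    unfolding K.Ker.fin_dim_def K.Ker.basis_def by auto
qed

text \<open>The rank is the dimension of the column space, which is the image of multiplication by
  \<open>A\<close>; this brings in rank-nullity for linear maps.\<close>

lemma rank_nullity_mat:
  assumes A: "A \<in> carrier_mat n n"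
  shows "rank A + vectorspace.dim class_ring (vs (mat_kernel A)) = n"
proof -
  interpret L: linear_map class_ring V V "(*\<^sub>v) A"
    by (rule linear_map_mult_mat_vec[OF A])
  have "L.imT = col_space A"
    using A by (auto simp: L.im_def col_space_eq[OF A])
  then show ?thesis
    using L.rank_nullity_main(1)[OF fin_dim]
    by (simp add: mat_kernel_eq_ker[OF A] rank_def col_space_def dim_is_n)
qed

lemma subspace_dim_mono:
  assumes "VectorSpace.subspace class_ring X V" "VectorSpace.subspace class_ring Y V" "X \<subseteq> Y"
    and "vectorspace.fin_dim class_ring (vs X)" "vectorspace.fin_dim class_ring (vs Y)"
  shows "vectorspace.dim class_ring (vs X) \<le> vectorspace.dim class_ring (vs Y)"
  using vectorspace.subspace_dim[OF subspace_is_vs[OF assms(2)] nested_subspaces[OF assms(2,1,3)] assms(5)]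
    assms(4) by simp

lemma col_space_subspace:
  assumes A: "A \<in> carrier_mat n n"
  shows "VectorSpace.subspace class_ring (col_space A) V"
    and "vectorspace.fin_dim class_ring (vs (col_space A))"
  using A cols_dim[of A] fin_dim_span_cols[OF A] by (auto simp: col_space_def intro!: span_is_subspace)

lemma rank_mult_le_left:
  assumes A: "A \<in> carrier_mat n n" and B: "B \<in> carrier_mat n n"
  shows "rank (A * B) \<le> rank A"
proof -
  have AB: "A * B \<in> carrier_mat n n" using A B by simp
  have "col_space (A * B) \<subseteq> col_space A"
    using A B by (auto simp: col_space_eq[OF A] col_space_eq[OF AB] intro!: bexI[of _ "B *\<^sub>v _"])
  then show ?thesis
    using subspace_dim_mono[OF col_space_subspace(1)[OF AB] col_space_subspace(1)[OF A]]
      col_space_subspace(2)[OF AB] col_space_subspace(2)[OF A]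
    by (simp add: rank_def col_space_def)
qed

text \<open>Left multiplication can only enlarge the kernel, and rank-nullity turns this into a
  bound on the rank.\<close>

lemma rank_mult_le_right:
  assumes A: "A \<in> carrier_mat n n" and B: "B \<in> carrier_mat n n"
  shows "rank (B * A) \<le> rank A"
proof -
  have BA: "B * A \<in> carrier_mat n n" using A B by simp
  have "vectorspace.dim class_ring (vs (mat_kernel A)) \<le> vectorspace.dim class_ring (vs (mat_kernel (B * A)))"
    by (intro subspace_dim_mono mat_kernel_subspace mat_kernel_mult_subset[OF A B] A BA)
  then show ?thesis
    using rank_nullity_mat[OF A] rank_nullity_mat[OF BA] by simp
qed

text \<open>A zero product places the column space of \<open>B\<close> inside the kernel of
  \<open>A\<close>, whose dimension is n minus the rank of \<open>A\<close>.\<close>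

lemma rank_add_le_if_mult_eq_0:
  assumes A: "A \<in> carrier_mat n n" and B: "B \<in> carrier_mat n n" and AB: "A * B = 0\<^sub>m n n"
  shows "rank A + rank B \<le> n"
proof -
  have "A *\<^sub>v (B *\<^sub>v v) = 0\<^sub>v n" if "v \<in> carrier_vec n" for v
    using assoc_mult_mat_vec[OF A B that, symmetric] that by (auto simp: AB)
  then have "col_space B \<subseteq> mat_kernel A"
    using B by (auto simp: col_space_eq[OF B] mat_kernel[OF A])
  then have "vectorspace.dim class_ring (vs (col_space B)) \<le> vectorspace.dim class_ring (vs (mat_kernel A))"
    by (intro subspace_dim_mono mat_kernel_subspace col_space_subspace A B)
  then show ?thesis
    using rank_nullity_mat[OF A] by (simp add: rank_def col_space_def)
qed

text \<open>A nonzero minor bounds the rank from below by its size. This is what truncates the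
  expansions in t below.\<close>

lemma det_principal_submatrix_eq_0_if_rank_less:
  assumes A: "A \<in> carrier_mat n n" and S: "S \<subseteq> {0..<n}" and r: "rank A < card S"
  shows "det (principal_submatrix A S) = 0"
proof (rule ccontr)
  assume "det (principal_submatrix A S) \<noteq> 0"
  moreover have "{j. j < n \<and> j \<in> S} = S" using S by auto
  ultimately show False
    using rank_gt_minor[OF A, of S S] r by (simp add: principal_submatrix_def)
qed

end

section \<open>Truncated expansions in t and their values at t = 0\<close>

lemma isCont_eq_at_0:
  fixes f g :: "complex \<Rightarrow> complex"
  assumes "isCont f 0" "isCont g 0" "\<And>t. t \<noteq> 0 \<Longrightarrow> f t = g t"
  shows "f 0 = g 0"
proof -
  have "f \<midarrow>0\<rightarrow> f 0" "g \<midarrow>0\<rightarrow> g 0"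
    using assms(1,2) by (simp_all add: isCont_def)
  moreover have "(f \<midarrow>0\<rightarrow> g 0) \<longleftrightarrow> (g \<midarrow>0\<rightarrow> g 0)"
    using assms(3) by (intro LIM_equal) simp
  ultimately show ?thesis by (metis LIM_unique)
qed

text \<open>What remains of the sum of t ^ (n - card S) * f S over all \<open>S\<close> after
  division by t ^ (n - r), when \<open>f\<close> vanishes on sets larger than \<open>r\<close>. It
  is a function of t and not a formal polynomial, because \<open>f\<close> may itself depend on t.
  The bound on \<open>card S\<close> keeps the natural subtraction exact.\<close>

definition graded_sum :: "nat \<Rightarrow> nat \<Rightarrow> (nat set \<Rightarrow> complex) \<Rightarrow> complex \<Rightarrow> complex" where
  "graded_sum n r f t = (\<Sum>S | S \<subseteq> {0..<n} \<and> card S \<le> r. t ^ (r - card S) * f S)"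

text \<open>Since 0 ^ 0 = 1, exactly the sets of size \<open>r\<close> survive.\<close>

lemma graded_sum_0: "graded_sum n r f 0 = (\<Sum>S | S \<subseteq> {0..<n} \<and> card S = r. f S)"
  unfolding graded_sum_def
  by (rule sum.mono_neutral_cong_right) (auto simp: power_0_left)

lemma isCont_graded_sum:
  assumes "\<And>S. S \<subseteq> {0..<n} \<Longrightarrow> isCont (\<lambda>t. f t S) a"
  shows "isCont (\<lambda>t. graded_sum n r (f t) t) a"
  unfolding graded_sum_def using assms by (auto intro!: continuous_intros)

lemma sum_eq_graded_sum:
  assumes "r \<le> n" "\<And>S. S \<subseteq> {0..<n} \<Longrightarrow> r < card S \<Longrightarrow> f S = 0"
  shows "(\<Sum>S | S \<subseteq> {0..<n}. t ^ (n - card S) * f S) = t ^ (n - r) * graded_sum n r f t"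
  unfolding graded_sum_def sum_distrib_left
  by (rule sum.mono_neutral_cong_right)
    (use assms in \<open>auto simp: not_le mult.assoc[symmetric] simp flip: power_add\<close>)

section \<open>Determinants of A + tI, with and without a replaced column\<close>

lemma prod_const_compl:
  assumes "S \<subseteq> {0..<n}"
  shows "(\<Prod>i\<in>{0..<n} - S. t) = (t :: 'a :: comm_ring_1) ^ (n - card S)"
  using assms finite_subset[OF assms] by (simp add: card_Diff_subset)

lemma det_add_scalar:
  fixes A :: "'a :: comm_ring_1 mat"
  assumes A: "A \<in> carrier_mat n n"
  shows "det (A + t \<cdot>\<^sub>m 1\<^sub>m n) = (\<Sum>S | S \<subseteq> {0..<n}. t ^ (n - card S) * det (principal_submatrix A S))"
proof -
  have "A + t \<cdot>\<^sub>m 1\<^sub>m n = A + mat n n (\<lambda>(i, j). if i = j then t else 0)"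
    by (rule eq_matI) (use A in auto)
  then show ?thesis
    by (simp add: det_add_diagonal[OF A] prod_const_compl del: prod_constant)
qed

text \<open>Replacing column \<open>i\<close> erases the t at diagonal position \<open>i\<close>.
  The perturbation therefore has a zero there, and any \<open>S\<close> omitting \<open>i\<close>
  picks up that zero factor.\<close>

lemma det_replace_col_add_scalar:
  fixes A :: "'a :: comm_ring_1 mat"
  assumes A: "A \<in> carrier_mat n n" and i: "i < n"
  shows "det (replace_col (A + t \<cdot>\<^sub>m 1\<^sub>m n) c i) = (\<Sum>S | S \<subseteq> {0..<n}.
    t ^ (n - card S) * (if i \<in> S then det (principal_submatrix (replace_col A c i) S) else 0))"
proof -
  let ?d = "\<lambda>a. if a = i then 0 else t"
  have R: "replace_col A c i \<in> carrier_mat n n" using A by (simp add: replace_col_def)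
  have "replace_col (A + t \<cdot>\<^sub>m 1\<^sub>m n) c i =
      replace_col A c i + mat n n (\<lambda>(a, b). if a = b then ?d a else 0)"
    by (rule eq_matI) (use A in \<open>auto simp: replace_col_def\<close>)
  moreover have "(\<Prod>a\<in>{0..<n} - S. ?d a) = (if i \<in> S then t ^ (n - card S) else 0)"
    if S: "S \<subseteq> {0..<n}" for S
  proof (cases "i \<in> S")
    case True
    then have "(\<Prod>a\<in>{0..<n} - S. ?d a) = (\<Prod>a\<in>{0..<n} - S. t)" by (intro prod.cong) auto
    then show ?thesis using True by (simp add: prod_const_compl[OF S] del: prod_constant)
  next
    case False
    then show ?thesis using i by (auto intro!: prod_zero bexI[of _ i])
  qed
  ultimately show ?thesis
    by (auto simp: det_add_diagonal[OF R] intro!: sum.cong)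
qed

section \<open>The limit t = 0: Cramer's rule with principal minors, and the nonzero
  denominator\<close>

lemma isCont_det_principal_submatrix:
  fixes A :: "complex \<Rightarrow> complex mat"
  assumes A: "\<And>t. A t \<in> carrier_mat n n" and S: "S \<subseteq> {0..<n}"
    and cont: "\<And>i j. i < n \<Longrightarrow> j < n \<Longrightarrow> isCont (\<lambda>t. A t $$ (i, j)) a"
  shows "isCont (\<lambda>t. det (principal_submatrix (A t) S)) a"
proof -
  have "isCont (\<lambda>t. A t $$ (i, p i)) a" if "p permutes S" "i \<in> S" for p i
    using that S permutes_in_image[of p S i] by (intro cont) auto
  then show ?thesis
    unfolding det_principal_submatrix[OF A S] by (auto intro!: continuous_intros)
qed

text \<open>The hypothesis \<open>vanish\<close> speaks of all right multiples of \<open>M\<close>,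
  so that it covers \<open>M\<close> itself and also \<open>M\<close> with a column replaced by
  another vector in its range. The preimage \<open>y\<close> of \<open>x\<close> supplies the latter
  factorization.\<close>

lemma cramer_principal_minors:
  fixes M :: "complex mat"
  assumes M: "M \<in> carrier_mat n n" and y: "y \<in> carrier_vec n" and i: "i < n" and r: "r \<le> n"
    and vanish: "\<And>K S. K \<in> carrier_mat n n \<Longrightarrow> S \<subseteq> {0..<n} \<Longrightarrow> r < card S \<Longrightarrow>
      det (principal_submatrix (M * K) S) = 0"
    and x: "x = M *\<^sub>v y"
  shows "x $ i * (\<Sum>S | S \<subseteq> {0..<n} \<and> card S = r. det (principal_submatrix M S)) =
    (\<Sum>S | S \<subseteq> {0..<n} \<and> card S = r \<and> i \<in> S.
      det (principal_submatrix (replace_col M (M *\<^sub>v x) i) S))"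
proof -
  \<comment> \<open>The new column is (M + tI)x, as Cramer's rule for M + tI requires; the t on the
    other diagonal positions is accounted for by \<open>det_replace_col_add_scalar\<close>.\<close>
  define N where "N t = replace_col M (M *\<^sub>v x + t \<cdot>\<^sub>v x) i" for t
  define f where "f t S = (if i \<in> S then det (principal_submatrix (N t) S) else 0)" for t S
  have xc: "x \<in> carrier_vec n" using M y x by simp
  have N: "N t \<in> carrier_mat n n" for t using M by (simp add: N_def replace_col_def)
  \<comment> \<open>Because x = My, the new column equals M(x + ty). Hence \<open>N t\<close> is a
    right multiple of \<open>M\<close>, and its minors of size above \<open>r\<close> vanish for
    every t.\<close>
  have N_eq: "N t = M * replace_col (1\<^sub>m n) (x + t \<cdot>\<^sub>v y) i" for t
  proof (rule mat_col_eqI)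
    fix j assume "j < dim_col (M * replace_col (1\<^sub>m n) (x + t \<cdot>\<^sub>v y) i)"
    then have j: "j < n" by (simp add: replace_col_def)
    have K: "replace_col (1\<^sub>m n) (x + t \<cdot>\<^sub>v y) i \<in> carrier_mat n n" by (simp add: replace_col_def)
    have "col (M * replace_col (1\<^sub>m n) (x + t \<cdot>\<^sub>v y) i) j =
        M *\<^sub>v col (replace_col (1\<^sub>m n) (x + t \<cdot>\<^sub>v y) i) j"
      by (rule col_mult2[OF M K j])
    also have "\<dots> = col (N t) j"
    proof (cases "j = i")
      case True
      have "col (replace_col (1\<^sub>m n) (x + t \<cdot>\<^sub>v y) i) j = x + t \<cdot>\<^sub>v y"
        using True i xc y by (intro eq_vecI) (auto simp: replace_col_def)
      moreover have "col (N t) j = M *\<^sub>v x + t \<cdot>\<^sub>v x"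
        using True i xc y M by (intro eq_vecI) (auto simp: N_def replace_col_def)
      ultimately show ?thesis
        using M xc y by (simp add: mult_add_distrib_mat_vec[OF M] mult_mat_vec[OF M] x)
    next
      case False
      have "col (replace_col (1\<^sub>m n) (x + t \<cdot>\<^sub>v y) i) j = unit_vec n j"
        using False j by (intro eq_vecI) (auto simp: replace_col_def unit_vec_def)
      moreover have "col (N t) j = col M j"
        using False j M by (intro eq_vecI) (auto simp: N_def replace_col_def)
      ultimately show ?thesis
        using col_mult2[OF M one_carrier_mat j] M j by simp
    qed
    finally show "col (N t) j = col (M * replace_col (1\<^sub>m n) (x + t \<cdot>\<^sub>v y) i) j" by simp
  qed (use M in \<open>auto simp: N_def replace_col_def\<close>)
  have f0: "f t S = 0" if "S \<subseteq> {0..<n}" "r < card S" for t S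
    unfolding f_def N_eq using that vanish by (simp add: replace_col_def)
  have M0: "det (principal_submatrix M S) = 0" if "S \<subseteq> {0..<n}" "r < card S" for S
    using vanish[of "1\<^sub>m n" S] M that by simp
  \<comment> \<open>Both determinants in Cramer's rule carry the factor t ^ (n - r), which cancels
    for nonzero t.\<close>
  have "x $ i * graded_sum n r (\<lambda>S. det (principal_submatrix M S)) t = graded_sum n r (f t) t"
    if t: "t \<noteq> 0" for t
  proof -
    have Mt: "M + t \<cdot>\<^sub>m 1\<^sub>m n \<in> carrier_mat n n" using M by simp
    have "(t \<cdot>\<^sub>m 1\<^sub>m n) *\<^sub>v x = t \<cdot>\<^sub>v x"
      using xc by (intro eq_vecI) simp_all
    then have "(M + t \<cdot>\<^sub>m 1\<^sub>m n) *\<^sub>v x = M *\<^sub>v x + t \<cdot>\<^sub>v x"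
      using M xc by (simp add: add_mult_distrib_mat_vec[of _ n n])
    then have "x $ i * det (M + t \<cdot>\<^sub>m 1\<^sub>m n) = det (replace_col (M + t \<cdot>\<^sub>m 1\<^sub>m n) (M *\<^sub>v x + t \<cdot>\<^sub>v x) i)"
      using cramer_lemma_mat[OF Mt xc i] by simp
    moreover have "det (M + t \<cdot>\<^sub>m 1\<^sub>m n) =
        t ^ (n - r) * graded_sum n r (\<lambda>S. det (principal_submatrix M S)) t"
      unfolding det_add_scalar[OF M] by (rule sum_eq_graded_sum[OF r M0])
    moreover have "det (replace_col (M + t \<cdot>\<^sub>m 1\<^sub>m n) (M *\<^sub>v x + t \<cdot>\<^sub>v x) i) =
        t ^ (n - r) * graded_sum n r (f t) t"
      unfolding det_replace_col_add_scalar[OF M i] N_def[symmetric] f_def[symmetric]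
      by (rule sum_eq_graded_sum[OF r f0])
    ultimately have "x $ i * (t ^ (n - r) * graded_sum n r (\<lambda>S. det (principal_submatrix M S)) t) =
        t ^ (n - r) * graded_sum n r (f t) t" by simp
    then show ?thesis using t by simp
  qed
  moreover have "isCont (\<lambda>t. x $ i * graded_sum n r (\<lambda>S. det (principal_submatrix M S)) t) 0"
    by (intro continuous_intros isCont_graded_sum)
  moreover have "isCont (\<lambda>t. graded_sum n r (f t) t) 0"
  proof (rule isCont_graded_sum)
    fix S assume S: "S \<subseteq> {0..<n}"
    have "isCont (\<lambda>t. N t $$ (a, b)) 0" if "a < n" "b < n" for a b
      using that M xc by (cases "b = i") (auto simp: N_def replace_col_def intro!: continuous_intros)
    then have "isCont (\<lambda>t. det (principal_submatrix (N t) S)) 0"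
      by (intro isCont_det_principal_submatrix[OF N S])
    then show "isCont (\<lambda>t. f t S) 0" by (cases "i \<in> S") (simp_all add: f_def)
  qed
  ultimately have "x $ i * graded_sum n r (\<lambda>S. det (principal_submatrix M S)) 0 = graded_sum n r (f 0) 0"
    by (intro isCont_eq_at_0[where f = "\<lambda>t. x $ i * graded_sum n r (\<lambda>S. det (principal_submatrix M S)) t"])
  moreover have "N 0 = replace_col M (M *\<^sub>v x) i"
    using M xc by (auto simp: N_def intro!: arg_cong[where f = "\<lambda>v. replace_col M v i"] eq_vecI)
  moreover have "(\<Sum>S | S \<subseteq> {0..<n} \<and> card S = r. f 0 S) =
      (\<Sum>S | S \<subseteq> {0..<n} \<and> card S = r \<and> i \<in> S. det (principal_submatrix (N 0) S))"
    by (rule sum.mono_neutral_cong_right) (auto simp: f_def)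
  ultimately show ?thesis by (simp add: graded_sum_0)
qed

text \<open>The hypotheses make \<open>G\<close> the group inverse of \<open>M\<close>, so E = MG is
  idempotent and F = I - E is the complementary projection. At t = 0 the comparison of determinants
  reads e_r(M) * e_(n-r)(F) = det (F + M), where e_m is the sum of the principal minors of size
  m.\<close>

lemma sum_principal_minors_nonzero:
  fixes M G :: "complex mat"
  assumes M: "M \<in> carrier_mat n n" and G: "G \<in> carrier_mat n n"
    and MGM: "M * G * M = M" and GMG: "G * M * G = G" and MG: "M * G = G * M"
  shows "(\<Sum>S | S \<subseteq> {0..<n} \<and> card S = vec_space.rank n M. det (principal_submatrix M S)) \<noteq> 0"
proof -
  interpret vec_space "TYPE(complex)" n .
  define r E F B where "r = rank M" and "E = M * G" and "F = 1\<^sub>m n - E" and "B = F + M"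
  have E: "E \<in> carrier_mat n n" using M G by (simp add: E_def)
  have F: "F \<in> carrier_mat n n" unfolding F_def by (rule minus_carrier_mat[OF E])
  have B: "B \<in> carrier_mat n n" using F M by (simp add: B_def)
  have ME: "M * E = M"
    using MGM assoc_mult_mat[OF M G M] by (simp add: E_def MG)
  have EG: "E * G = G"
    using GMG by (simp add: E_def MG)
  have EE: "E * E = E"
    using assoc_mult_mat[OF E M G] MGM by (simp add: E_def)
  have MF: "M * F = 0\<^sub>m n n"
    using mult_minus_distrib_mat[OF M one_carrier_mat E] M by (simp add: F_def ME)
  have FG: "F * G = 0\<^sub>m n n"
    using minus_mult_distrib_mat[OF one_carrier_mat E G] G by (simp add: F_def EG)
  have FF: "F * F = F"
  proof -
    have "E * F = 0\<^sub>m n n"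
      using mult_minus_distrib_mat[OF E one_carrier_mat E] E by (simp add: F_def EE)
    then show ?thesis
      using minus_mult_distrib_mat[OF one_carrier_mat E F] F
      by (subst (1) F_def) (auto intro!: eq_matI)
  qed
  \<comment> \<open>\<open>G + F\<close> is an explicit inverse of \<open>B\<close>: the mixed
    products vanish and what is left is E + F = I.\<close>
  have "B * (G + F) = F * G + M * G + (F * F + M * F)"
    using F M G by (simp add: B_def add_mult_distrib_mat[of _ n n] mult_add_distrib_mat[of _ n n])
  also have "\<dots> = E + F" using F E by (simp add: FG FF MF E_def)
  also have "\<dots> = 1\<^sub>m n" using E by (intro eq_matI) (auto simp: F_def)
  finally have "det B * det (G + F) = 1"
    using det_mult[OF B, of "G + F"] G F by simp
  then have detB: "det B \<noteq> 0" by auto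
  have le: "r + rank F \<le> n"
    unfolding r_def by (rule rank_add_le_if_mult_eq_0[OF M F MF])
  define g h where "g = graded_sum n r (\<lambda>S. det (principal_submatrix M S))"
    and "h = graded_sum n (n - r) (\<lambda>S. det (principal_submatrix F S))"
  have "g t * h t = graded_sum n n (\<lambda>S. det (principal_submatrix B S)) t" if t: "t \<noteq> 0" for t
  proof -
    let ?T = "t \<cdot>\<^sub>m 1\<^sub>m n"
    have T: "?T \<in> carrier_mat n n" by simp
    have smult: "?T * K = t \<cdot>\<^sub>m K" "K * ?T = t \<cdot>\<^sub>m K" if "K \<in> carrier_mat n n" for K
      using that by (auto simp: mult_smult_distrib[of _ n n])
    have "(M + ?T) * (F + ?T) = M * F + t \<cdot>\<^sub>m F + t \<cdot>\<^sub>m (M + ?T)"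
      using M F T by (simp add: add_mult_distrib_mat[of _ n n] mult_add_distrib_mat[of _ n n] smult)
    also have "\<dots> = t \<cdot>\<^sub>m (B + ?T)"
      unfolding MF B_def using M F by (intro eq_matI) (auto simp: algebra_simps)
    finally have "det (M + ?T) * det (F + ?T) = t ^ n * det (B + ?T)"
      using det_mult[of "M + ?T" n "F + ?T"] M F B by simp
    moreover have "det (M + ?T) = t ^ (n - r) * g t"
      unfolding det_add_scalar[OF M] g_def
      using det_principal_submatrix_eq_0_if_rank_less[OF M] le
      by (intro sum_eq_graded_sum) (auto simp: r_def)
    \<comment> \<open>Since \<open>n - r\<close> bounds the rank of \<open>F\<close>, this
      determinant carries t ^ r; together with t ^ (n - r) from \<open>M\<close> it balances the t ^
      n on the other side.\<close>
    moreover have "det (F + ?T) = t ^ (n - (n - r)) * h t"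
      unfolding det_add_scalar[OF F] h_def
      using det_principal_submatrix_eq_0_if_rank_less[OF F] le
      by (intro sum_eq_graded_sum) auto
    \<comment> \<open>No subset has more than n elements, so truncation at n loses nothing. This
      form only brings \<open>B\<close> under the same continuity argument.\<close>
    moreover have "det (B + ?T) = t ^ (n - n) * graded_sum n n (\<lambda>S. det (principal_submatrix B S)) t"
      unfolding det_add_scalar[OF B]
      by (intro sum_eq_graded_sum) (auto simp: subset_eq_atLeast0_lessThan_card leD)
    ultimately have "t ^ (n - r) * t ^ r * (g t * h t) =
        t ^ n * graded_sum n n (\<lambda>S. det (principal_submatrix B S)) t"
      using le by (simp add: mult_ac)
    then show ?thesis using t le by (simp flip: power_add)
  qed
  then have "g 0 * h 0 = graded_sum n n (\<lambda>S. det (principal_submatrix B S)) 0"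
    by (intro isCont_eq_at_0[where f = "\<lambda>t. g t * h t"])
      (auto simp: g_def h_def intro!: continuous_intros isCont_graded_sum)
  \<comment> \<open>The expansion of det (B + tI) is read backwards at t = 0.\<close>
  also have "\<dots> = det (B + 0 \<cdot>\<^sub>m 1\<^sub>m n)"
    unfolding det_add_scalar[OF B]
    by (subst sum_eq_graded_sum[of n]) (auto simp: subset_eq_atLeast0_lessThan_card leD)
  also have "B + 0 \<cdot>\<^sub>m 1\<^sub>m n = B" using B by (intro eq_matI) auto
  finally have "g 0 \<noteq> 0" using detB by auto
  then show ?thesis by (simp add: g_def graded_sum_0 r_def)
qed

section \<open>Powers of commuting matrices, and transposition\<close>

lemma pow_mat_commute:
  fixes A B :: "'a :: comm_ring_1 mat"
  assumes A: "A \<in> carrier_mat n n" and B: "B \<in> carrier_mat n n" and AB: "A * B = B * A"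
  shows "A ^\<^sub>m m * B = B * A ^\<^sub>m m"
proof (induction m)
  case (Suc m)
  have P: "A ^\<^sub>m m \<in> carrier_mat n n" using A by simp
  have "A ^\<^sub>m m * A * B = A ^\<^sub>m m * (B * A)"
    using assoc_mult_mat[OF P A B] by (simp add: AB)
  also have "\<dots> = B * (A ^\<^sub>m m * A)"
    using assoc_mult_mat[OF P B A] assoc_mult_mat[OF B P A] by (simp add: Suc)
  finally show ?case by simp
qed (use A B in auto)

lemma pow_mat_mult_distrib:
  fixes A B :: "'a :: comm_ring_1 mat"
  assumes A: "A \<in> carrier_mat n n" and B: "B \<in> carrier_mat n n" and AB: "A * B = B * A"
  shows "A ^\<^sub>m m * B ^\<^sub>m m = (A * B) ^\<^sub>m m"
proof (induction m)
  case (Suc m)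
  have P: "A ^\<^sub>m m \<in> carrier_mat n n" "B ^\<^sub>m m \<in> carrier_mat n n" using A B by auto
  have "A ^\<^sub>m Suc m * B ^\<^sub>m Suc m = A ^\<^sub>m m * (A * B ^\<^sub>m m) * B"
    using A B P by (simp add: assoc_mult_mat[of _ n n _ n _ n] mult_carrier_mat[of _ n n _ n])
  also have "A * B ^\<^sub>m m = B ^\<^sub>m m * A"
    using pow_mat_commute[OF B A, of m] AB by simp
  also have "A ^\<^sub>m m * (B ^\<^sub>m m * A) * B = (A * B) ^\<^sub>m Suc m"
    using A B P by (simp add: assoc_mult_mat[of _ n n _ n _ n] mult_carrier_mat[of _ n n _ n] flip: Suc)
  finally show ?case .
qed (use A B in auto)

lemma principal_submatrix_transpose:
  assumes "A \<in> carrier_mat n n" "S \<subseteq> {0..<n}"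
  shows "principal_submatrix A\<^sup>T S = (principal_submatrix A S)\<^sup>T"
proof -
  have "{i. i < n \<and> i \<in> S} = S" using assms(2) by auto
  moreover have "pick S i < n" if "i < card S" for i
    using pick_in_set_le[OF that] assms(2) by auto
  ultimately show ?thesis
    using assms(1)
    by (intro eq_matI) (simp_all add: principal_submatrix_def dim_submatrix submatrix_index)
qed

lemma det_principal_submatrix_transpose:
  fixes A :: "'a :: comm_ring_1 mat"
  assumes A: "A \<in> carrier_mat n n" and S: "S \<subseteq> {0..<n}"
  shows "det (principal_submatrix A\<^sup>T S) = det (principal_submatrix A S)"
  unfolding principal_submatrix_transpose[OF A S]
  by (rule det_transpose[OF principal_submatrix_carrier[OF A S]])

text \<open>Lets the row formula be deduced from the column formula for the transposed
  matrix.\<close>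

lemma replace_row_eq_transpose:
  assumes "A \<in> carrier_mat n n"
  shows "replace_row A c i = (replace_col A\<^sup>T c i)\<^sup>T"
  by (rule eq_matI) (use assms in \<open>auto simp: replace_row_def replace_col_def\<close>)

section \<open>Determinantal representations of the Drazin inverse\<close>

theorem theorem2p7:
  fixes A X :: "complex mat" and n k r :: nat
  assumes A: "A \<in> carrier_mat n n"
    and k: "mat_index A = k"
    and r: "crank (A ^\<^sub>m (Suc k)) = r" "crank (A ^\<^sub>m k) = r" "r \<le> n"
    and X: "is_drazin_inverse A X"
  shows "\<forall>i<n. \<forall>j<n.
      X $$ (i, j) =
        (\<Sum>\<alpha>\<in>{\<alpha>. \<alpha> \<subseteq> {0..<n} \<and> card \<alpha> = r \<and> j \<in> \<alpha>}.
            det (principal_submatrix (replace_row (A ^\<^sub>m (Suc k)) (row (A ^\<^sub>m k) i) j) \<alpha>))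
        / (\<Sum>\<alpha>\<in>{\<alpha>. \<alpha> \<subseteq> {0..<n} \<and> card \<alpha> = r}.
            det (principal_submatrix (A ^\<^sub>m (Suc k)) \<alpha>))
    \<and> X $$ (i, j) =
        (\<Sum>\<beta>\<in>{\<beta>. \<beta> \<subseteq> {0..<n} \<and> card \<beta> = r \<and> i \<in> \<beta>}.
            det (principal_submatrix (replace_col (A ^\<^sub>m (Suc k)) (col (A ^\<^sub>m k) j) i) \<beta>))
        / (\<Sum>\<beta>\<in>{\<beta>. \<beta> \<subseteq> {0..<n} \<and> card \<beta> = r}.
            det (principal_submatrix (A ^\<^sub>m (Suc k)) \<beta>))"
proof (intro allI impI)
  fix i j assume i: "i < n" and j: "j < n"
  interpret vec_space "TYPE(complex)" n .
  \<comment> \<open>\<open>G\<close> will be the group inverse of \<open>M\<close>: since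
    \<open>X\<close> commutes with \<open>A\<close>, both \<open>M * G\<close> and
    \<open>G * M\<close> are powers of the idempotent \<open>A * X\<close>, hence equal to
    it.\<close>
  define M N G where "M = A ^\<^sub>m Suc k" and "N = A ^\<^sub>m k" and "G = X ^\<^sub>m Suc k"
  let ?e = "\<Sum>S | S \<subseteq> {0..<n} \<and> card S = r. det (principal_submatrix M S)"
  have Xc: "X \<in> carrier_mat n n" and MX: "M * X = N" and XAX: "X * A * X = X" and AX: "A * X = X * A"
    using X A k by (auto simp: is_drazin_inverse_def M_def N_def simp del: pow_mat.simps)
  have M: "M \<in> carrier_mat n n" and N: "N \<in> carrier_mat n n" and G: "G \<in> carrier_mat n n"
    using A Xc by (auto simp: M_def N_def G_def simp del: pow_mat.simps)
  note assoc = assoc_mult_mat[of _ n n _ n _ n] and mult_carrier = mult_carrier_mat[of _ n n _ n]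
  have AXc: "A * X \<in> carrier_mat n n" using A Xc by simp
  have XM: "X * M = N"
    using pow_mat_commute[OF A Xc AX, of "Suc k"] MX by (simp add: M_def del: pow_mat.simps)
  have "(A * X) * (A * X) = A * X"
    using A Xc XAX by (simp add: assoc mult_carrier)
  \<comment> \<open>The exponent is a successor because the zeroth power would be the
    identity.\<close>
  then have "(A * X) ^\<^sub>m Suc m = A * X" for m
    using AXc by (induction m) auto
  then have MG: "M * G = A * X"
    unfolding M_def G_def by (simp add: pow_mat_mult_distrib[OF A Xc AX] del: pow_mat.simps)
  have GM: "G * M = A * X"
    unfolding M_def G_def
    by (metis pow_mat_mult_distrib[OF Xc A AX[symmetric]] pow_mat_mult_distrib[OF A Xc AX] AX MG M_def G_def)
  have MGM: "M * G * M = M"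
  proof -
    have "M * G * M = M * (X * A)" using M G by (simp add: assoc mult_carrier GM AX)
    also have "\<dots> = N * A" using M Xc A by (simp add: assoc[symmetric] mult_carrier MX)
    finally show ?thesis by (simp add: M_def N_def)
  qed
  have GMG: "G * M * G = G"
  proof -
    have "G * M * G = X ^\<^sub>m k * X * (A * X)" using M G by (simp add: assoc mult_carrier MG) (simp add: G_def)
    also have "\<dots> = X ^\<^sub>m k * (X * A * X)" using A Xc by (simp add: assoc mult_carrier)
    finally show ?thesis by (simp add: XAX G_def)
  qed
  \<comment> \<open>Factoring \<open>M\<close> out on the left puts every column of \<open>X\<close>
    in the range of \<open>M\<close>; the companion factorization on the right does the same for the
    rows after transposing.\<close>
  have X_left: "X = M * (G * X)"
  proof -
    have "M * (G * X) = M * G * X" using M G Xc by (simp add: assoc mult_carrier)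
    then show ?thesis by (simp add: MG AX XAX)
  qed
  have X_right: "X = X * G * M"
  proof -
    have "X * G * M = X * (G * M)" using M G Xc by (simp add: assoc mult_carrier)
    also have "\<dots> = X" using A Xc XAX by (simp add: GM assoc mult_carrier)
    finally show ?thesis by simp
  qed
  have rank: "rank M = r" using r(1) A by (simp add: crank_def M_def del: pow_mat.simps)
  have e: "?e \<noteq> 0"
    using sum_principal_minors_nonzero[OF M G MGM GMG] MG GM by (simp add: rank)
  have "X $$ (i, j) * ?e =
      (\<Sum>S | S \<subseteq> {0..<n} \<and> card S = r \<and> i \<in> S. det (principal_submatrix (replace_col M (col N j) i) S))"
  proof -
    let ?y = "col (G * X) j"
    have x: "col X j = M *\<^sub>v ?y"
      using col_mult2[OF M _ j, of "G * X"] G Xc X_left by simp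
    have c: "M *\<^sub>v col X j = col N j"
      using col_mult2[OF M Xc j] by (simp add: MX)
    have "det (principal_submatrix (M * K) S) = 0"
      if K: "K \<in> carrier_mat n n" and S: "S \<subseteq> {0..<n}" "r < card S" for K S
      using rank_mult_le_left[OF M K] S rank M K
      by (intro det_principal_submatrix_eq_0_if_rank_less) auto
    from cramer_principal_minors[OF M _ i r(3) this x] show ?thesis
      using i j G Xc by (simp add: c)
  qed
  moreover have "X $$ (i, j) * ?e =
      (\<Sum>S | S \<subseteq> {0..<n} \<and> card S = r \<and> j \<in> S. det (principal_submatrix (replace_row M (row N i) j) S))"
  proof -
    \<comment> \<open>Row \<open>i\<close> of \<open>X\<close> is treated as column \<open>i\<close>
      of its transpose, so Cramer's rule is applied to the transpose of \<open>M\<close> at position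
      \<open>j\<close>.\<close>
    let ?y = "col (X * G)\<^sup>T i"
    have MT: "M\<^sup>T \<in> carrier_mat n n" and XT: "X\<^sup>T \<in> carrier_mat n n" using M Xc by auto
    have x: "col X\<^sup>T i = M\<^sup>T *\<^sub>v ?y"
    proof -
      have "X\<^sup>T = M\<^sup>T * (X * G)\<^sup>T"
        using transpose_mult[of "X * G" n n M n] M G Xc X_right by simp
      then show ?thesis using col_mult2[OF MT _ i, of "(X * G)\<^sup>T"] G Xc by simp
    qed
    have c: "M\<^sup>T *\<^sub>v col X\<^sup>T i = row N i"
      using col_mult2[OF MT XT i] transpose_mult[OF Xc M, symmetric] N i by (simp add: XM)
    have "det (principal_submatrix (M\<^sup>T * K) S) = 0"
      if K: "K \<in> carrier_mat n n" and S: "S \<subseteq> {0..<n}" "r < card S" for K S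
    proof -
      have KM: "K\<^sup>T * M \<in> carrier_mat n n" using K M by simp
      \<comment> \<open>Transposing preserves principal minors, so it suffices to bound the rank of
        \<open>K\<^sup>T * M\<close> by that of \<open>M\<close>.\<close>
      have "M\<^sup>T * K = (K\<^sup>T * M)\<^sup>T" using transpose_mult[of "K\<^sup>T" n n M n] K M by simp
      then show ?thesis
        using rank_mult_le_right[OF M, of "K\<^sup>T"] K S rank
        by (simp add: det_principal_submatrix_transpose[OF KM]
            det_principal_submatrix_eq_0_if_rank_less[OF KM])
    qed
    from cramer_principal_minors[OF MT _ j r(3) this x]
    have "X $$ (i, j) * (\<Sum>S | S \<subseteq> {0..<n} \<and> card S = r. det (principal_submatrix M\<^sup>T S)) =
      (\<Sum>S | S \<subseteq> {0..<n} \<and> card S = r \<and> j \<in> S.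
        det (principal_submatrix (replace_col M\<^sup>T (row N i) j) S))"
      unfolding c using i j G Xc by simp
    moreover have "replace_col M\<^sup>T (row N i) j \<in> carrier_mat n n"
      using M by (simp add: replace_col_def)
    ultimately show ?thesis
      by (simp add: replace_row_eq_transpose[OF M] det_principal_submatrix_transpose[OF M]
          det_principal_submatrix_transpose cong: conj_cong)
  qed
  ultimately show "X $$ (i, j) =
        (\<Sum>\<alpha>\<in>{\<alpha>. \<alpha> \<subseteq> {0..<n} \<and> card \<alpha> = r \<and> j \<in> \<alpha>}.
            det (principal_submatrix (replace_row (A ^\<^sub>m (Suc k)) (row (A ^\<^sub>m k) i) j) \<alpha>))
        / (\<Sum>\<alpha>\<in>{\<alpha>. \<alpha> \<subseteq> {0..<n} \<and> card \<alpha> = r}.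
            det (principal_submatrix (A ^\<^sub>m (Suc k)) \<alpha>))
    \<and> X $$ (i, j) =
        (\<Sum>\<beta>\<in>{\<beta>. \<beta> \<subseteq> {0..<n} \<and> card \<beta> = r \<and> i \<in> \<beta>}.
            det (principal_submatrix (replace_col (A ^\<^sub>m (Suc k)) (col (A ^\<^sub>m k) j) i) \<beta>))
        / (\<Sum>\<beta>\<in>{\<beta>. \<beta> \<subseteq> {0..<n} \<and> card \<beta> = r}.
            det (principal_submatrix (A ^\<^sub>m (Suc k)) \<beta>))"
    using e unfolding M_def[symmetric] N_def[symmetric] by (simp add: eq_divide_eq)
qed

end
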